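(* Let $S_1$ and $S_2$ be two cohomogeneity one structures on a Riemannian manifold $(M,g)$ associated with the same unit vector field $\xi$, and let $\tilde T_i$ be the torsion of $\tilde\nabla_i=\nabla-S_i$, $i=1,2$, where $\nabla$ is the Levi-Civita connection. Assume $\tilde T_1(\xi,\,\cdot\,)=0$ and $\tilde T_2(\xi,\,\cdot\,)=0$. If $\Pi_{\mathcal T(V)}(S_1)=\Pi_{\mathcal T(V)}(S_2)$ (at every point, with $V$ the tangent space at that point), then $S_1=S_2$.
   Context: A cohomogeneity one structure on $(M,g)$ associated with a unit vector field $\xi$ is a $(1,2)$-tensor field $S=\nabla-\tilde\nabla$, where $\nabla$ is the Levi-Civita connection and $\tilde\nabla$ is a linear connection with curvature $\tilde R$ and torsion $\tilde T$ satisfying $\tilde\nabla\tilde R=0$, $\tilde\nabla\tilde T=0$, $\tilde\nabla\xi=0$, and $\tilde\nabla_Xg=0$, $\tilde T(X,Y)\in\mathcal D$ for all $X,Y\in\mathcal D$, where $\mathcal D=\{X: g(X,\xi)=0\}$. For $V=T_pM$, $D=\xi_p^\perp\subset V$, write $S_{XYZ}=g(S_XY,Z)$. $\mathcal T(V)=D^*\otimes (D^*\wedge D^* )$, and $\Pi_{\mathcal T(V)}(S)$ is the $\mathcal T(V)$-component of $S$, i.e. the restriction of $(X,Y,Z)\mapsto S_{XYZ}$ to $X,Y,Z\in D$. *)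

theory Defs
  imports "HOL-Analysis.Analysis" "HOL-Library.Function_Algebras"
begin

text \<open>
  The manifold is the whole type \<^typ>\<open>'m\<close>, which carries a Hausdorff second countable
  topology; its smooth structure is given by a (not necessarily maximal) atlas \<open>A\<close> of charts with
  values in a Euclidean space. Addition, subtraction and zero of functions, of tangent vectors and
  of vector fields are the pointwise operations of \<open>Function_Algebras\<close>.
\<close>

subsection \<open>Smooth manifolds\<close>

text \<open>Only used for open \<open>W\<close>.\<close>

primrec Ck_on :: "nat \<Rightarrow> 'a::euclidean_space set \<Rightarrow> ('a \<Rightarrow> 'b::euclidean_space) \<Rightarrow> bool" where
  "Ck_on 0 W f \<longleftrightarrow> continuous_on W f"
| "Ck_on (Suc k) W f \<longleftrightarrow>
     (\<forall>x\<in>W. f differentiable (at x)) \<and> (\<forall>v. Ck_on k W (\<lambda>x. frechet_derivative f (at x) v))"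

definition smooth_on :: "'a::euclidean_space set \<Rightarrow> ('a \<Rightarrow> 'b::euclidean_space) \<Rightarrow> bool" where
  "smooth_on W f \<longleftrightarrow> (\<forall>k. Ck_on k W f)"

type_synonym ('m, 'e) atlas = "('m set \<times> ('m \<Rightarrow> 'e)) set"

definition smooth_atlas ::
  "('m::{t2_space, second_countable_topology}, 'e::euclidean_space) atlas \<Rightarrow> bool" where
  "smooth_atlas A \<longleftrightarrow>
     (\<Union>(U, \<phi>)\<in>A. U) = UNIV \<and>
     (\<forall>(U, \<phi>)\<in>A. open U \<and> open (\<phi> ` U) \<and> homeomorphism U (\<phi> ` U) \<phi> (inv_into U \<phi>)) \<and>
     (\<forall>(U, \<phi>)\<in>A. \<forall>(V, \<psi>)\<in>A. smooth_on (\<phi> ` (U \<inter> V)) (\<psi> \<circ> inv_into U \<phi>))"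

definition smooth_fun :: "('m, 'e::euclidean_space) atlas \<Rightarrow> ('m \<Rightarrow> real) \<Rightarrow> bool" where
  "smooth_fun A f \<longleftrightarrow> (\<forall>(U, \<phi>)\<in>A. smooth_on (\<phi> ` U) (f \<circ> inv_into U \<phi>))"


subsection \<open>Tangent vectors and vector fields\<close>

type_synonym 'm tvec = "('m \<Rightarrow> real) \<Rightarrow> real"
type_synonym 'm vfield = "'m \<Rightarrow> 'm tvec"

text \<open>
  Tangent vectors at \<open>p\<close> are the derivations at \<open>p\<close> of the algebra of smooth functions. They are
  required to vanish on non-smooth functions, so that two of them are equal in HOL if and only if
  they agree on smooth functions.
\<close>

definition tangent_space :: "('m, 'e::euclidean_space) atlas \<Rightarrow> 'm \<Rightarrow> 'm tvec set" where
  "tangent_space A p = {v.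
     (\<forall>f. \<not> smooth_fun A f \<longrightarrow> v f = 0) \<and>
     (\<forall>f h. smooth_fun A f \<longrightarrow> smooth_fun A h \<longrightarrow> v (f + h) = v f + v h) \<and>
     (\<forall>a f. smooth_fun A f \<longrightarrow> v (\<lambda>q. a * f q) = a * v f) \<and>
     (\<forall>f h. smooth_fun A f \<longrightarrow> smooth_fun A h \<longrightarrow> v (f * h) = v f * h p + f p * v h)}"

definition tscale :: "real \<Rightarrow> 'm tvec \<Rightarrow> 'm tvec" where
  "tscale a v = (\<lambda>f. a * v f)"

definition fscale :: "('m \<Rightarrow> real) \<Rightarrow> 'm vfield \<Rightarrow> 'm vfield" where
  "fscale h X = (\<lambda>p. tscale (h p) (X p))"

definition vf_apply :: "'m vfield \<Rightarrow> ('m \<Rightarrow> real) \<Rightarrow> 'm \<Rightarrow> real" where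
  "vf_apply X f = (\<lambda>p. X p f)"

definition vector_fields :: "('m, 'e::euclidean_space) atlas \<Rightarrow> 'm vfield set" where
  "vector_fields A = {X.
     (\<forall>p. X p \<in> tangent_space A p) \<and> (\<forall>f. smooth_fun A f \<longrightarrow> smooth_fun A (vf_apply X f))}"

definition lie_bracket :: "'m vfield \<Rightarrow> 'm vfield \<Rightarrow> 'm vfield" where
  "lie_bracket X Y = (\<lambda>p f. X p (vf_apply Y f) - Y p (vf_apply X f))"

definition linear_form_at ::
  "('m, 'e::euclidean_space) atlas \<Rightarrow> 'm \<Rightarrow> ('m tvec \<Rightarrow> real) \<Rightarrow> bool" where
  "linear_form_at A p L \<longleftrightarrow>
     (\<forall>u\<in>tangent_space A p. \<forall>v\<in>tangent_space A p. L (u + v) = L u + L v) \<and>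
     (\<forall>a. \<forall>u\<in>tangent_space A p. L (tscale a u) = a * L u)"


subsection \<open>Metrics and (1,2)-tensor fields\<close>

type_synonym 'm metric = "'m \<Rightarrow> 'm tvec \<Rightarrow> 'm tvec \<Rightarrow> real"

definition riemannian_metric :: "('m, 'e::euclidean_space) atlas \<Rightarrow> 'm metric \<Rightarrow> bool" where
  "riemannian_metric A g \<longleftrightarrow>
     (\<forall>p. \<forall>u\<in>tangent_space A p. linear_form_at A p (g p u)) \<and>
     (\<forall>p. \<forall>u\<in>tangent_space A p. \<forall>v\<in>tangent_space A p. g p u v = g p v u) \<and>
     (\<forall>p. \<forall>u\<in>tangent_space A p. u \<noteq> 0 \<longrightarrow> g p u u > 0) \<and>
     (\<forall>X\<in>vector_fields A. \<forall>Y\<in>vector_fields A. smooth_fun A (\<lambda>p. g p (X p) (Y p)))"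

type_synonym 'm tensor12 = "'m \<Rightarrow> 'm tvec \<Rightarrow> 'm tvec \<Rightarrow> 'm tvec"

text \<open>A smooth family of bilinear maps; \<open>S p u v\<close> is only meaningful for \<open>u\<close>, \<open>v\<close> tangent at \<open>p\<close>.\<close>

definition tensor_field12 :: "('m, 'e::euclidean_space) atlas \<Rightarrow> 'm tensor12 \<Rightarrow> bool" where
  "tensor_field12 A S \<longleftrightarrow>
     (\<forall>p. \<forall>u\<in>tangent_space A p. \<forall>v\<in>tangent_space A p. S p u v \<in> tangent_space A p) \<and>
     (\<forall>p. \<forall>u\<in>tangent_space A p. \<forall>f.
        linear_form_at A p (\<lambda>v. S p u v f) \<and> linear_form_at A p (\<lambda>v. S p v u f)) \<and>
     (\<forall>X\<in>vector_fields A. \<forall>Y\<in>vector_fields A. (\<lambda>p. S p (X p) (Y p)) \<in> vector_fields A)"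


subsection \<open>Linear connections\<close>

text \<open>\<open>nabla X Y\<close> is the covariant derivative of \<open>Y\<close> along \<open>X\<close>.\<close>

type_synonym 'm conn = "'m vfield \<Rightarrow> 'm vfield \<Rightarrow> 'm vfield"

definition linear_connection :: "('m, 'e::euclidean_space) atlas \<Rightarrow> 'm conn \<Rightarrow> bool" where
  "linear_connection A nabla \<longleftrightarrow>
     (\<forall>X\<in>vector_fields A. \<forall>Y\<in>vector_fields A. nabla X Y \<in> vector_fields A) \<and>
     (\<forall>X\<in>vector_fields A. \<forall>X'\<in>vector_fields A. \<forall>Y\<in>vector_fields A.
        nabla (X + X') Y = nabla X Y + nabla X' Y) \<and>
     (\<forall>X\<in>vector_fields A. \<forall>Y\<in>vector_fields A. \<forall>f. smooth_fun A f \<longrightarrow>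
        nabla (fscale f X) Y = fscale f (nabla X Y)) \<and>
     (\<forall>X\<in>vector_fields A. \<forall>Y\<in>vector_fields A. \<forall>Y'\<in>vector_fields A.
        nabla X (Y + Y') = nabla X Y + nabla X Y') \<and>
     (\<forall>X\<in>vector_fields A. \<forall>Y\<in>vector_fields A. \<forall>f. smooth_fun A f \<longrightarrow>
        nabla X (fscale f Y) = fscale (vf_apply X f) Y + fscale f (nabla X Y))"

definition torsion :: "'m conn \<Rightarrow> 'm vfield \<Rightarrow> 'm vfield \<Rightarrow> 'm vfield" where
  "torsion nabla X Y = nabla X Y - nabla Y X - lie_bracket X Y"

definition curvature :: "'m conn \<Rightarrow> 'm vfield \<Rightarrow> 'm vfield \<Rightarrow> 'm vfield \<Rightarrow> 'm vfield" where
  "curvature nabla X Y Z =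
     nabla X (nabla Y Z) - nabla Y (nabla X Z) - nabla (lie_bracket X Y) Z"

definition cov_deriv_metric ::
  "'m conn \<Rightarrow> 'm metric \<Rightarrow> 'm vfield \<Rightarrow> 'm vfield \<Rightarrow> 'm vfield \<Rightarrow> 'm \<Rightarrow> real" where
  "cov_deriv_metric nabla g W X Y = (\<lambda>p.
     W p (\<lambda>q. g q (X q) (Y q)) - g p (nabla W X p) (Y p) - g p (X p) (nabla W Y p))"

definition cov_deriv_torsion :: "'m conn \<Rightarrow> 'm vfield \<Rightarrow> 'm vfield \<Rightarrow> 'm vfield \<Rightarrow> 'm vfield" where
  "cov_deriv_torsion nabla W X Y =
     nabla W (torsion nabla X Y) - torsion nabla (nabla W X) Y - torsion nabla X (nabla W Y)"

definition cov_deriv_curvature ::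
  "'m conn \<Rightarrow> 'm vfield \<Rightarrow> 'm vfield \<Rightarrow> 'm vfield \<Rightarrow> 'm vfield \<Rightarrow> 'm vfield" where
  "cov_deriv_curvature nabla W X Y Z =
     nabla W (curvature nabla X Y Z) - curvature nabla (nabla W X) Y Z
       - curvature nabla X (nabla W Y) Z - curvature nabla X Y (nabla W Z)"

definition levi_civita ::
  "('m, 'e::euclidean_space) atlas \<Rightarrow> 'm metric \<Rightarrow> 'm conn \<Rightarrow> bool" where
  "levi_civita A g nabla \<longleftrightarrow>
     linear_connection A nabla \<and>
     (\<forall>X\<in>vector_fields A. \<forall>Y\<in>vector_fields A. torsion nabla X Y = 0) \<and>
     (\<forall>W\<in>vector_fields A. \<forall>X\<in>vector_fields A. \<forall>Y\<in>vector_fields A.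
        cov_deriv_metric nabla g W X Y = 0)"

definition conn_minus :: "'m conn \<Rightarrow> 'm tensor12 \<Rightarrow> 'm conn" where
  "conn_minus nabla S = (\<lambda>X Y p. nabla X Y p - S p (X p) (Y p))"


subsection \<open>Cohomogeneity one structures\<close>

definition unit_vector_field ::
  "('m, 'e::euclidean_space) atlas \<Rightarrow> 'm metric \<Rightarrow> 'm vfield \<Rightarrow> bool" where
  "unit_vector_field A g \<xi> \<longleftrightarrow> \<xi> \<in> vector_fields A \<and> (\<forall>p. g p (\<xi> p) (\<xi> p) = 1)"

definition orth_space ::
  "('m, 'e::euclidean_space) atlas \<Rightarrow> 'm metric \<Rightarrow> 'm vfield \<Rightarrow> 'm \<Rightarrow> 'm tvec set" where
  "orth_space A g \<xi> p = {u \<in> tangent_space A p. g p u (\<xi> p) = 0}"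

definition orth_fields ::
  "('m, 'e::euclidean_space) atlas \<Rightarrow> 'm metric \<Rightarrow> 'm vfield \<Rightarrow> 'm vfield set" where
  "orth_fields A g \<xi> = {X \<in> vector_fields A. \<forall>p. X p \<in> orth_space A g \<xi> p}"

text \<open>
  Here \<open>nabla\<close> is the Levi-Civita connection and \<open>conn_minus nabla S\<close> the connection with respect
  to which torsion, curvature and \<open>\<xi>\<close> are parallel. The metric is required to be parallel only in
  the directions orthogonal to \<open>\<xi>\<close>.
\<close>

definition cohomogeneity_one_structure ::
  "('m, 'e::euclidean_space) atlas \<Rightarrow> 'm metric \<Rightarrow> 'm conn \<Rightarrow> 'm vfield \<Rightarrow> 'm tensor12 \<Rightarrow> bool" where
  "cohomogeneity_one_structure A g nabla \<xi> S \<longleftrightarrow>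
     tensor_field12 A S \<and>
     (let nabla' = conn_minus nabla S in
        linear_connection A nabla' \<and>
        (\<forall>W\<in>vector_fields A. \<forall>X\<in>vector_fields A. \<forall>Y\<in>vector_fields A. \<forall>Z\<in>vector_fields A.
           cov_deriv_curvature nabla' W X Y Z = 0) \<and>
        (\<forall>W\<in>vector_fields A. \<forall>X\<in>vector_fields A. \<forall>Y\<in>vector_fields A.
           cov_deriv_torsion nabla' W X Y = 0) \<and>
        (\<forall>X\<in>vector_fields A. nabla' X \<xi> = 0) \<and>
        (\<forall>X\<in>orth_fields A g \<xi>. \<forall>Y\<in>vector_fields A. \<forall>Z\<in>vector_fields A.
           cov_deriv_metric nabla' g X Y Z = 0) \<and>
        (\<forall>X\<in>orth_fields A g \<xi>. \<forall>Y\<in>orth_fields A g \<xi>. torsion nabla' X Y \<in> orth_fields A g \<xi>))"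

definition Pi_T ::
  "('m, 'e::euclidean_space) atlas \<Rightarrow> 'm metric \<Rightarrow> 'm vfield \<Rightarrow> 'm tensor12 \<Rightarrow> 'm
     \<Rightarrow> 'm tvec \<Rightarrow> 'm tvec \<Rightarrow> 'm tvec \<Rightarrow> real" where
  "Pi_T A g \<xi> S p =
     (\<lambda>X\<in>orth_space A g \<xi> p. \<lambda>Y\<in>orth_space A g \<xi> p. \<lambda>Z\<in>orth_space A g \<xi> p. g p (S p X Y) Z)"

end

theory Submission
  imports Defs
begin

text \<open>
  Both connections \<open>\<nabla> - S\<^sub>i\<close> come from the same Levi-Civita connection, so every axiom that can be
  solved for a component of \<open>S\<close> determines that component from \<open>\<nabla>\<close> alone. At a point, for the
  splitting of the tangent space into the line of \<open>\<xi>\<close> and its orthogonal complement \<open>D\<close>, this gives: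

  \<^item> the values \<open>S(X, \<xi>)\<close>, because \<open>\<xi>\<close> is parallel: \<open>S(X, \<xi>) = \<nabla>\<^sub>X \<xi>\<close>
    (\<open>cohomogeneity_one_structure_xi_right\<close>);
  \<^item> the values \<open>S(\<xi>, X)\<close>, because the torsion vanishes on \<open>(\<xi>, X)\<close> and \<open>\<xi>\<close> is parallel:
    \<open>S(\<xi>, X) = \<nabla>\<^sub>\<xi> X - [\<xi>, X]\<close> (\<open>cohomogeneity_one_structure_xi_left\<close>);
  \<^item> the \<open>\<xi>\<close>-component of \<open>S(X, Y)\<close> for \<open>X\<close> in \<open>D\<close>, because the metric is parallel along \<open>X\<close>:
    \<open>g(S(X, Y), \<xi>) = g(\<nabla>\<^sub>X Y, \<xi>) - X(g(Y, \<xi>))\<close> (\<open>cohomogeneity_one_structure_xi_component\<close>).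

  What is left is the \<open>D\<close>-component of \<open>S\<close> on \<open>D \<times> D\<close>, and this is the part on which the two
  structures agree by hypothesis. Bilinearity and positivity of the metric put the pieces together.

  These identities speak about vector fields, whereas the conclusion speaks about tangent vectors
  at a point, so every tangent vector has to be the value of a global vector field
  (\<open>tangent_vector_extends_to_vector_field\<close>). Since tangent vectors are abstract derivations of the
  algebra of smooth functions, this is where most of the work lies. Hadamard's lemma
  (\<open>smooth_on_Hadamard\<close>) writes a smooth function near \<open>p\<close> as its value at \<open>p\<close> plus a combination of
  coordinates vanishing at \<open>p\<close>, so the product rule forces a derivation at \<open>p\<close> to be a directional
  derivative in a chart (\<open>tangent_vector_eq_directional_derivative\<close>); the directional derivative in
  the same coordinate direction at nearby points, multiplied by a bump function, is the required
  vector field.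
\<close>

section \<open>Calculus of \<open>C\<^sup>k\<close> functions\<close>

lemma Ck_on_subset: "Ck_on k W f \<Longrightarrow> V \<subseteq> W \<Longrightarrow> Ck_on k V f"
  by (induction k arbitrary: f) (auto intro: continuous_on_subset)

lemma Ck_on_cong:
  assumes "open W" "\<And>x. x \<in> W \<Longrightarrow> f x = h x" "Ck_on k W f"
  shows "Ck_on k W h"
  using assms(2,3)
proof (induction k arbitrary: f h)
  case 0
  then show ?case by (simp cong: continuous_on_cong)
next
  case (Suc k)
  have der: "(h has_derivative frechet_derivative f (at x)) (at x)" if "x \<in> W" for x
    using has_derivative_transform_within_open[OF _ assms(1) that, of f _ UNIV h] Suc.prems that
    by (simp add: frechet_derivative_works)
  have "frechet_derivative h (at x) = frechet_derivative f (at x)" if "x \<in> W" for x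
    using frechet_derivative_at[OF der[OF that]] by simp
  then show ?case
    using Suc.prems Suc.IH[of "\<lambda>x. frechet_derivative f (at x) v" "\<lambda>x. frechet_derivative h (at x) v" for v]
      differentiableI[OF der] by auto
qed

text \<open>
  In the definition the derivative is the one chosen by \<^const>\<open>frechet_derivative\<close>; this rule lets a
  derivative be exhibited by a formula instead, which is how the inductions on the order below run.
\<close>

lemma Ck_on_SucI:
  assumes "open W" "\<And>x. x \<in> W \<Longrightarrow> (f has_derivative f' x) (at x)" "\<And>v. Ck_on k W (\<lambda>x. f' x v)"
  shows "Ck_on (Suc k) W f"
proof -
  have "Ck_on k W (\<lambda>x. frechet_derivative f (at x) v)" for v
    by (rule Ck_on_cong[OF assms(1) _ assms(3)[of v]]) (simp add: frechet_derivative_at[OF assms(2)])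
  then show ?thesis using assms(2) by (auto simp: differentiable_def)
qed

lemma Ck_on_has_derivative:
  "Ck_on (Suc k) W f \<Longrightarrow> x \<in> W \<Longrightarrow> (f has_derivative frechet_derivative f (at x)) (at x)"
  by (simp add: frechet_derivative_works)

lemma Ck_on_SucD: "Ck_on (Suc k) W f \<Longrightarrow> Ck_on k W f"
proof (induction k arbitrary: f)
  case 0
  then show ?case
    by (auto intro!: continuous_at_imp_continuous_on differentiable_imp_continuous_within)
next
  case (Suc k)
  show ?case unfolding Ck_on.simps(2)[of k]
    using Suc.prems Suc.IH unfolding Ck_on.simps(2)[of "Suc k"] by blast
qed

lemma Ck_on_imp_continuous_on: "Ck_on k W f \<Longrightarrow> continuous_on W f"
  by (induction k) (auto dest: Ck_on_SucD simp del: Ck_on.simps(2))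

text \<open>
  Functions on a manifold that are given by different formulas on different open sets are handled
  by checking smoothness near each point separately.
\<close>

lemma Ck_on_local:
  assumes "\<And>x. x \<in> W \<Longrightarrow> \<exists>N. open N \<and> x \<in> N \<and> Ck_on k N f"
  shows "Ck_on k W f"
  using assms
proof (induction k arbitrary: f)
  case 0
  have "isCont f x" if x: "x \<in> W" for x
  proof -
    obtain N where N: "open N" "x \<in> N" "Ck_on 0 N f"
      using "0.prems"[OF x] by blast
    then show ?thesis by (simp add: continuous_on_eq_continuous_at)
  qed
  then show ?case
    by (simp add: continuous_at_imp_continuous_on)
next
  case (Suc k)
  have "Ck_on k W (\<lambda>x. frechet_derivative f (at x) v)" for v
  proof (rule Suc.IH)
    fix x assume "x \<in> W"
    then show "\<exists>N. open N \<and> x \<in> N \<and> Ck_on k N (\<lambda>x. frechet_derivative f (at x) v)"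
      using Suc.prems[of x] unfolding Ck_on.simps by blast
  qed
  then show ?case
    using Suc.prems unfolding Ck_on.simps by blast
qed

lemma Ck_on_const: "Ck_on k W (\<lambda>x. c)"
  by (induction k arbitrary: c) (auto simp: frechet_derivative_const)

lemma Ck_on_add:
  assumes "open W" "Ck_on k W f" "Ck_on k W h"
  shows "Ck_on k W (\<lambda>x. f x + h x)"
  using assms(2,3)
proof (induction k arbitrary: f h)
  case (Suc k)
  have "((\<lambda>x. f x + h x) has_derivative
      (\<lambda>v. frechet_derivative f (at x) v + frechet_derivative h (at x) v)) (at x)" if "x \<in> W" for x
    using Suc.prems that by (intro has_derivative_add Ck_on_has_derivative)
  then show ?case
    using Suc by (intro Ck_on_SucI[OF assms(1)]) auto
qed (auto intro: continuous_intros)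

lemma Ck_on_sum:
  assumes "open W" "\<And>i. i \<in> I \<Longrightarrow> Ck_on k W (f i)"
  shows "Ck_on k W (\<lambda>x. \<Sum>i\<in>I. f i x)"
  using assms(2) by (induction I rule: infinite_finite_induct)
    (auto intro: Ck_on_const Ck_on_add[OF assms(1)])

lemma Ck_on_mult:
  fixes f h :: "'a::euclidean_space \<Rightarrow> real"
  assumes "open W" "Ck_on k W f" "Ck_on k W h"
  shows "Ck_on k W (\<lambda>x. f x * h x)"
  using assms(2,3)
proof (induction k arbitrary: f h)
  case (Suc k)
  have "((\<lambda>x. f x * h x) has_derivative
      (\<lambda>v. f x * frechet_derivative h (at x) v + frechet_derivative f (at x) v * h x)) (at x)"
    if "x \<in> W" for x
    using Suc.prems that by (intro has_derivative_mult Ck_on_has_derivative)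
  moreover have "Ck_on k W f" "Ck_on k W h"
    using Suc.prems[THEN Ck_on_SucD] .
  ultimately show ?case
    using Suc
    by (intro Ck_on_SucI[OF assms(1), where f' = "\<lambda>x v. f x * frechet_derivative h (at x) v +
        frechet_derivative f (at x) v * h x"]) (auto intro!: Ck_on_add[OF assms(1)])
qed (auto intro: continuous_intros)

lemma Ck_on_bounded_linear_compose:
  assumes "open W" "bounded_linear L" "Ck_on k W f"
  shows "Ck_on k W (\<lambda>x. L (f x))"
  using assms(3)
proof (induction k arbitrary: f)
  case 0
  then show ?case by (simp add: bounded_linear.continuous_on[OF assms(2)])
next
  case (Suc k)
  have "((\<lambda>x. L (f x)) has_derivative (\<lambda>v. L (frechet_derivative f (at x) v))) (at x)"
    if "x \<in> W" for x
    using Suc.prems that by (intro bounded_linear.has_derivative[OF assms(2)] Ck_on_has_derivative)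
  then show ?case
    using Suc by (intro Ck_on_SucI[OF assms(1)]) auto
qed

lemma Ck_on_ident:
  assumes "open W"
  shows "Ck_on k W (\<lambda>x. x)"
proof (cases k)
  case (Suc j)
  then show ?thesis
    by (auto intro!: Ck_on_SucI[OF assms, where f' = "\<lambda>_ v. v"] has_derivative_ident Ck_on_const
        simp del: Ck_on.simps)
qed simp

text \<open>
  By the chain rule, the derivative of \<open>f \<circ> h\<close> in direction \<open>v\<close> is the derivative of \<open>f\<close> at \<open>h x\<close>
  in a direction that itself depends on \<open>x\<close>. Expanding that direction in the standard basis leaves
  products of components of \<open>h'\<close> with partial derivatives of \<open>f\<close> composed with \<open>h\<close>, to which the
  induction hypothesis applies.
\<close>

lemma Ck_on_compose:
  fixes f :: "'b::euclidean_space \<Rightarrow> real"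
  assumes "open W" "Ck_on k V f" "Ck_on k W h" "h ` W \<subseteq> V"
  shows "Ck_on k W (\<lambda>x. f (h x))"
  using assms(2,3)
proof (induction k arbitrary: f)
  case 0
  then show ?case
    using assms(4) continuous_on_compose2[of V f W h] by simp
next
  case (Suc k)
  let ?f' = "\<lambda>y. frechet_derivative f (at y)" and ?h' = "\<lambda>x. frechet_derivative h (at x)"
  have exp: "?f' y w = (\<Sum>i\<in>Basis. (w \<bullet> i) * ?f' y i)" if "y \<in> V" for y w
  proof -
    have lin: "linear (?f' y)"
      using Ck_on_has_derivative[OF Suc.prems(1) that] has_derivative_linear by blast
    have "?f' y w = ?f' y (\<Sum>i\<in>Basis. (w \<bullet> i) *\<^sub>R i)"
      by (simp add: euclidean_representation)
    also have "\<dots> = (\<Sum>i\<in>Basis. (w \<bullet> i) * ?f' y i)"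
      by (simp only: linear_sum[OF lin] linear_cmul[OF lin] real_scaleR_def)
    finally show ?thesis .
  qed
  have "((\<lambda>x. f (h x)) has_derivative (\<lambda>v. \<Sum>i\<in>Basis. (?h' x v \<bullet> i) * ?f' (h x) i)) (at x)"
    if x: "x \<in> W" for x
  proof -
    have hx: "h x \<in> V" using x assms(4) by blast
    have eq: "(\<lambda>v. ?f' (h x) (?h' x v)) = (\<lambda>v. \<Sum>i\<in>Basis. (?h' x v \<bullet> i) * ?f' (h x) i)"
      by (rule ext) (rule exp[OF hx])
    show ?thesis
      using has_derivative_compose[OF Ck_on_has_derivative[OF Suc.prems(2) x]
          Ck_on_has_derivative[OF Suc.prems(1) hx]] unfolding eq .
  qed
  moreover have "Ck_on k W (\<lambda>x. \<Sum>i\<in>Basis. (?h' x v \<bullet> i) * ?f' (h x) i)" for v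
  proof (intro Ck_on_sum[OF assms(1)] Ck_on_mult[OF assms(1)])
    fix i :: 'b
    show "Ck_on k W (\<lambda>x. ?h' x v \<bullet> i)"
      using Suc.prems(2)
      by (intro Ck_on_bounded_linear_compose[OF assms(1) bounded_linear_inner_left]) simp
    show "Ck_on k W (\<lambda>x. ?f' (h x) i)"
      using Suc.prems(1) by (intro Suc.IH Ck_on_SucD[OF Suc.prems(2)]) simp
  qed
  ultimately show ?case
    by (rule Ck_on_SucI[OF assms(1)])
qed

section \<open>Bump functions\<close>

text \<open>
  The derivative of \<open>exp (-1/x)\<close>, continued by zero to the left of \<open>0\<close>, is not of the same form, but
  the functions \<open>exp (-1/x) / x\<^sup>n\<close> together are closed under differentiation up to linear
  combinations. The family therefore admits an induction on the order for all \<open>n\<close> at once.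
\<close>

definition flat_exp :: "nat \<Rightarrow> real \<Rightarrow> real" where
  "flat_exp n x = (if x > 0 then exp (- 1 / x) / x ^ n else 0)"

text \<open>
  With \<open>y = 1/x\<close> this is the fact that \<open>exp y\<close> dominates every power of \<open>y\<close>. As the difference
  quotient of the \<open>n\<close>-th function at \<open>0\<close> is the next function in the family, it also yields the
  derivative at \<open>0\<close>.
\<close>

lemma flat_exp_tendsto_0: "(flat_exp n \<longlongrightarrow> 0) (at 0)"
proof -
  have "((\<lambda>y::real. y ^ n / exp y) \<longlongrightarrow> 0) at_top"
    by (rule tendsto_power_div_exp_0)
  then have "((\<lambda>x::real. inverse x ^ n / exp (inverse x)) \<longlongrightarrow> 0) (at_right 0)"
    by (rule filterlim_compose[OF _ filterlim_inverse_at_top_right])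
  then have "(flat_exp n \<longlongrightarrow> 0) (at_right 0)"
    by (rule Lim_transform_eventually)
      (auto simp: eventually_at_filter flat_exp_def exp_minus field_simps)
  moreover have "(flat_exp n \<longlongrightarrow> 0) (at_left 0)"
    by (rule tendsto_eventually) (auto simp: eventually_at_filter flat_exp_def)
  ultimately show ?thesis
    by (simp add: filterlim_split_at)
qed

lemma flat_exp_has_derivative:
  "(flat_exp n has_real_derivative flat_exp (n + 2) x - real n * flat_exp (n + 1) x) (at x)"
proof (cases x "0::real" rule: linorder_cases)
  case less
  have "((\<lambda>x. 0) has_real_derivative 0) (at x)" by simp
  then have "(flat_exp n has_real_derivative 0) (at x)"
    by (rule has_field_derivative_transform_within_open[where S = "{..<0}"])
      (use less in \<open>auto simp: flat_exp_def\<close>)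
  then show ?thesis using less by (simp add: flat_exp_def)
next
  case equal
  have "((\<lambda>h. (flat_exp n (0 + h) - flat_exp n 0) / h) \<longlongrightarrow> 0) (at 0)"
    by (rule Lim_transform_eventually[OF flat_exp_tendsto_0[of "Suc n"]])
      (auto simp: eventually_at_filter flat_exp_def)
  then show ?thesis using equal by (simp add: DERIV_def flat_exp_def)
next
  case greater
  have "((\<lambda>x. x ^ n) has_real_derivative real n * x ^ n / x) (at x)"
    using DERIV_pow[of n x UNIV] greater by (cases n) auto
  moreover have "((\<lambda>x. exp (- 1 / x)) has_real_derivative exp (- 1 / x) / x\<^sup>2) (at x)"
    using greater by (auto intro!: derivative_eq_intros simp: power2_eq_square)
  ultimately have "((\<lambda>x. exp (- 1 / x) / x ^ n) has_real_derivative
      (exp (- 1 / x) / x\<^sup>2 * x ^ n - exp (- 1 / x) * (real n * x ^ n / x)) / (x ^ n * x ^ n)) (at x)"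
    using greater by (intro DERIV_divide) auto
  also have "(exp (- 1 / x) / x\<^sup>2 * x ^ n - exp (- 1 / x) * (real n * x ^ n / x)) / (x ^ n * x ^ n) =
      flat_exp (n + 2) x - real n * flat_exp (n + 1) x"
    using greater by (simp add: flat_exp_def divide_simps power2_eq_square algebra_simps)
  finally have "((\<lambda>x. exp (- 1 / x) / x ^ n) has_real_derivative
      flat_exp (n + 2) x - real n * flat_exp (n + 1) x) (at x)" .
  then show ?thesis
    by (rule has_field_derivative_transform_within_open[where S = "{0<..}"])
      (use greater in \<open>auto simp: flat_exp_def\<close>)
qed

lemma Ck_on_flat_exp: "Ck_on k UNIV (flat_exp n)"
proof (induction k arbitrary: n)
  case 0
  show ?case
    using DERIV_isCont[OF flat_exp_has_derivative] by (auto intro!: continuous_at_imp_continuous_on)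
next
  case (Suc k)
  have "(flat_exp n has_derivative
      (\<lambda>v. (flat_exp (n + 2) x + (- real n) * flat_exp (n + 1) x) * v)) (at x)" for x
    using flat_exp_has_derivative[of n x] by (simp add: has_field_derivative_def)
  then show ?case
    by (intro Ck_on_SucI[of _ _ "\<lambda>x v. (flat_exp (n + 2) x + (- real n) * flat_exp (n + 1) x) * v"]
        Ck_on_mult Ck_on_add Ck_on_const Suc.IH) auto
qed

lemma smooth_bump_exists:
  fixes c :: "'e::euclidean_space"
  assumes "0 < r"
  obtains b :: "'e \<Rightarrow> real"
  where "smooth_on UNIV b" "b c = 1" "\<And>x. x \<notin> cball c r \<Longrightarrow> b x = 0"
proof
  \<comment> \<open>The argument \<open>r\<^sup>2 - |x - c|\<^sup>2\<close> is polynomial in \<open>x\<close> and positive exactly on the open ball.\<close>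
  let ?q = "\<lambda>x. r\<^sup>2 + (-1) * (\<Sum>i\<in>Basis. ((x - c) \<bullet> i) * ((x - c) \<bullet> i))"
  let ?b = "\<lambda>x. inverse (flat_exp 0 (r\<^sup>2)) * flat_exp 0 (?q x)"
  have q: "?q x = r\<^sup>2 - (dist c x)\<^sup>2" for x
    by (simp add: dist_norm norm_minus_commute[of c] power2_norm_eq_inner
        flip: euclidean_inner)
  have "Ck_on k UNIV (\<lambda>x. (x - c) \<bullet> i)" for k i
    using Ck_on_add[OF _ Ck_on_ident Ck_on_const[of _ _ "-c"], of UNIV k]
    by (intro Ck_on_bounded_linear_compose[OF _ bounded_linear_inner_left]) auto
  then have "Ck_on k UNIV ?b" for k
    by (intro Ck_on_mult Ck_on_const Ck_on_compose[OF _ Ck_on_flat_exp] Ck_on_add Ck_on_sum) auto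
  then show "smooth_on UNIV ?b" by (simp add: smooth_on_def)
  show "?b c = 1" using assms by (simp add: flat_exp_def)
  show "?b x = 0" if "x \<notin> cball c r" for x
  proof -
    have "r\<^sup>2 < (dist c x)\<^sup>2"
      using that assms by (intro power_strict_mono) auto
    then show ?thesis unfolding q by (simp add: flat_exp_def)
  qed
qed

section \<open>Hadamard's lemma\<close>

lemma radial_point_in_ball:
  fixes c :: "'e::euclidean_space"
  assumes "x \<in> ball c R" "t \<in> {0..1}"
  shows "c + t *\<^sub>R (x - c) \<in> ball c R"
proof -
  have "t * norm (x - c) \<le> 1 * norm (x - c)" using assms by (intro mult_right_mono) auto
  then show ?thesis using assms by (simp add: dist_norm norm_minus_commute)
qed

lemma continuous_on_radial_integrand:
  fixes h :: "'e::euclidean_space \<Rightarrow> real"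
  assumes "continuous_on (ball c R) h"
  shows "continuous_on (ball c R \<times> {0..1}) (\<lambda>(x, t). t ^ n * h (c + t *\<^sub>R (x - c)))"
proof -
  have "continuous_on (ball c R \<times> {0..1}) (\<lambda>z. h (c + snd z *\<^sub>R (fst z - c)))"
    by (rule continuous_on_compose2[OF assms])
      (auto intro!: continuous_intros radial_point_in_ball simp del: mem_ball)
  then show ?thesis
    unfolding case_prod_unfold by (intro continuous_on_mult continuous_on_power continuous_on_snd continuous_on_id)
qed

lemma continuous_on_radial_integrand_slice:
  fixes h :: "'e::euclidean_space \<Rightarrow> real"
  assumes "continuous_on (ball c R) h" "x \<in> ball c R"
  shows "continuous_on {0..1} (\<lambda>t. t ^ n * h (c + t *\<^sub>R (x - c)))"
proof -
  have "continuous_on {0..1} (Pair x)" "Pair x ` {0..1} \<subseteq> ball c R \<times> {0..1::real}"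
    using assms(2) by (auto intro: continuous_intros)
  from continuous_on_compose2[OF continuous_on_radial_integrand[OF assms(1)] this] show ?thesis
    by simp
qed

text \<open>
  Differentiation under the integral sign. Differentiating \<open>f (c + t (x - c))\<close> in \<open>x\<close> produces
  another factor \<open>t\<close>; allowing an arbitrary power of \<open>t\<close> as weight makes the class of radial
  integrals closed under directional derivatives.
\<close>

lemma has_derivative_radial_integral:
  fixes f :: "'e::euclidean_space \<Rightarrow> real"
  assumes f: "\<And>y. y \<in> ball c R \<Longrightarrow> (f has_derivative f' y) (at y)"
    and f': "\<And>v. continuous_on (ball c R) (\<lambda>y. f' y v)"
    and x: "x \<in> ball c R"
  shows "((\<lambda>x. integral {0..1} (\<lambda>t. t ^ n * f (c + t *\<^sub>R (x - c)))) has_derivative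
    (\<lambda>v. integral {0..1} (\<lambda>t. t ^ Suc n * f' (c + t *\<^sub>R (x - c)) v))) (at x)"
proof -
  \<comment> \<open>The derivative of the integrand as an element of the Banach space of bounded linear maps, where
    continuity can be tested on a basis.\<close>
  define F' where "F' y t = Blinfun (\<lambda>v. t ^ Suc n * f' (c + t *\<^sub>R (y - c)) v)" for y and t :: real
  have F': "blinfun_apply (F' y t) = (\<lambda>v. t ^ Suc n * f' (c + t *\<^sub>R (y - c)) v)"
    if "y \<in> ball c R" "t \<in> {0..1}" for y t
    unfolding F'_def
    by (intro bounded_linear_Blinfun_apply bounded_linear_const_mult
        has_derivative_bounded_linear[OF f[OF radial_point_in_ball[OF that]]])
  have cf: "continuous_on (ball c R) f"
    using f has_derivative_continuous by (blast intro: continuous_at_imp_continuous_on)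
  have "((\<lambda>x. integral (cbox 0 1) (\<lambda>t. t ^ n * f (c + t *\<^sub>R (x - c)))) has_derivative
      blinfun_apply (integral (cbox 0 1) (F' x))) (at x within ball c R)"
  proof (rule leibniz_rule)
    fix y t assume y: "y \<in> ball c R" and "t \<in> cbox (0::real) 1"
    then have t: "t \<in> {0..1}" by simp
    let ?y = "c + t *\<^sub>R (y - c)"
    have fy: "(f has_derivative f' ?y) (at ?y)"
      by (rule f[OF radial_point_in_ball[OF y t]])
    have "((\<lambda>x. c + t *\<^sub>R (x - c)) has_derivative (\<lambda>v. t *\<^sub>R v)) (at y)"
      by (auto intro!: derivative_eq_intros)
    from has_derivative_compose[OF this, of f "f' ?y"] fy
    have "((\<lambda>x. f (c + t *\<^sub>R (x - c))) has_derivative (\<lambda>v. f' ?y (t *\<^sub>R v))) (at y)"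
      by blast
    then have "((\<lambda>x. t ^ n * f (c + t *\<^sub>R (x - c))) has_derivative
        (\<lambda>v. t ^ n * f' ?y (t *\<^sub>R v))) (at y)"
      by (rule has_derivative_mult_right)
    moreover have "t ^ n * f' ?y (t *\<^sub>R v) = t ^ Suc n * f' ?y v" for v
      using has_derivative_linear[OF fy] by (simp add: linear_cmul)
    ultimately show "((\<lambda>x. t ^ n * f (c + t *\<^sub>R (x - c))) has_derivative blinfun_apply (F' y t))
        (at y within ball c R)"
      unfolding F'[OF y t] by (simp only: has_derivative_at_withinI)
  next
    fix y assume "y \<in> ball c R"
    then show "(\<lambda>t. t ^ n * f (c + t *\<^sub>R (y - c))) integrable_on cbox 0 1"
      using continuous_on_radial_integrand_slice[OF cf] by (intro integrable_continuous) simp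
  next
    show "continuous_on (ball c R \<times> cbox 0 1) (\<lambda>(x, t). F' x t)"
    proof (rule continuous_on_blinfun_componentwise)
      fix i :: 'e
      have "continuous_on (ball c R \<times> cbox 0 1) (\<lambda>(x, t). t ^ Suc n * f' (c + t *\<^sub>R (x - c)) i)"
        using continuous_on_radial_integrand[OF f', of "Suc n"] by (simp only: box_real)
      then show "continuous_on (ball c R \<times> cbox 0 1) (\<lambda>z. blinfun_apply (case z of (x, t) \<Rightarrow> F' x t) i)"
        by (rule continuous_on_eq) (auto simp: F' simp del: power_Suc mem_ball)
    qed
  qed (rule x, rule convex_ball)
  then have "((\<lambda>x. integral {0..1} (\<lambda>t. t ^ n * f (c + t *\<^sub>R (x - c)))) has_derivative
      blinfun_apply (integral {0..1} (F' x))) (at x)"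
    by (simp only: box_real at_within_open[OF x open_ball])
  moreover have "blinfun_apply (integral {0..1} (F' x)) =
      (\<lambda>v. integral {0..1} (\<lambda>t. t ^ Suc n * f' (c + t *\<^sub>R (x - c)) v))"
  proof
    fix v
    have "continuous_on {0..1} (F' x)"
    proof (rule continuous_on_blinfun_componentwise)
      fix i :: 'e
      show "continuous_on {0..1} (\<lambda>t. blinfun_apply (F' x t) i)"
        by (rule continuous_on_eq[OF continuous_on_radial_integrand_slice[OF f' x, of "Suc n"]])
          (simp only: F'[OF x])
    qed
    then have "blinfun_apply (integral {0..1} (F' x)) v =
        integral {0..1} (\<lambda>t. blinfun_apply (F' x t) v)"
      by (intro blinfun_apply_integral integrable_continuous_real)
    also have "\<dots> = integral {0..1} (\<lambda>t. t ^ Suc n * f' (c + t *\<^sub>R (x - c)) v)"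
      by (rule integral_cong) (simp only: F'[OF x])
    finally show "blinfun_apply (integral {0..1} (F' x)) v =
      integral {0..1} (\<lambda>t. t ^ Suc n * f' (c + t *\<^sub>R (x - c)) v)" .
  qed
  ultimately show ?thesis by (simp only:)
qed

lemma Ck_on_radial_integral:
  fixes f :: "'e::euclidean_space \<Rightarrow> real"
  assumes "Ck_on k (ball c R) f"
  shows "Ck_on k (ball c R) (\<lambda>x. integral {0..1} (\<lambda>t. t ^ n * f (c + t *\<^sub>R (x - c))))"
  using assms
proof (induction k arbitrary: f n)
  case 0
  then have "continuous_on (ball c R \<times> {0..1}) (\<lambda>(x, t). t ^ n * f (c + t *\<^sub>R (x - c)))"
    by (intro continuous_on_radial_integrand) simp
  then show ?case
    using integral_continuous_on_param[of "ball c R" 0 1 "\<lambda>x t. t ^ n * f (c + t *\<^sub>R (x - c))"]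
    by simp
next
  case (Suc k)
  let ?f' = "\<lambda>y. frechet_derivative f (at y)"
  have f': "Ck_on k (ball c R) (\<lambda>y. ?f' y v)" for v
    using Suc.prems by simp
  show ?case
    by (rule Ck_on_SucI[OF open_ball has_derivative_radial_integral[where f' = ?f']
        Suc.IH[OF f']])
      (use Ck_on_has_derivative[OF Suc.prems] Ck_on_imp_continuous_on[OF f'] in \<open>simp_all del: power_Suc\<close>)
qed

text \<open>
  Integrate the derivative of \<open>t \<mapsto> F (c + t (x - c))\<close> over the unit interval and split the direction
  \<open>x - c\<close> into coordinates: the coefficient functions are radial integrals of the partial derivatives
  of \<open>F\<close>, hence smooth.
\<close>

lemma smooth_on_Hadamard:
  fixes F :: "'e::euclidean_space \<Rightarrow> real"
  assumes "smooth_on (ball c R) F" "0 < R"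
  obtains G :: "'e \<Rightarrow> 'e \<Rightarrow> real"
  where "\<And>i. smooth_on (ball c R) (G i)"
    "\<And>i. G i c = frechet_derivative F (at c) i"
    "\<And>x. x \<in> ball c R \<Longrightarrow> F x = F c + (\<Sum>i\<in>Basis. ((x - c) \<bullet> i) * G i x)"
proof
  let ?F' = "\<lambda>y. frechet_derivative F (at y)"
  let ?G = "\<lambda>i x. integral {0..1} (\<lambda>t. t ^ 0 * ?F' (c + t *\<^sub>R (x - c)) i)"
  have F: "Ck_on k (ball c R) F" for k
    using assms by (simp add: smooth_on_def)
  then have F': "Ck_on k (ball c R) (\<lambda>y. ?F' y i)" for k i
    using Ck_on.simps(2)[of k] by blast
  show "smooth_on (ball c R) (?G i)" for i
    unfolding smooth_on_def using Ck_on_radial_integral[OF F'] by blast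
  show "?G i c = ?F' c i" for i
    by simp
  show "F x = F c + (\<Sum>i\<in>Basis. ((x - c) \<bullet> i) * ?G i x)" if x: "x \<in> ball c R" for x
  proof -
    have der: "(F has_derivative ?F' y) (at y)" if "y \<in> ball c R" for y
      using Ck_on_has_derivative[OF F that] .
    have "((\<lambda>t. F (c + t *\<^sub>R (x - c))) has_vector_derivative ?F' (c + t *\<^sub>R (x - c)) (x - c))
        (at t within {0..1})" if t: "t \<in> {0..1}" for t
    proof -
      have "((\<lambda>t. c + t *\<^sub>R (x - c)) has_derivative (\<lambda>s. s *\<^sub>R (x - c))) (at t within {0..1})"
        by (auto intro!: derivative_eq_intros)
      from has_derivative_compose[OF this, of F "?F' (c + t *\<^sub>R (x - c))"]
        der[OF radial_point_in_ball[OF x t]]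
      have "((\<lambda>t. F (c + t *\<^sub>R (x - c))) has_derivative
          (\<lambda>s. ?F' (c + t *\<^sub>R (x - c)) (s *\<^sub>R (x - c)))) (at t within {0..1})"
        by blast
      then show ?thesis
        using has_derivative_linear[OF der[OF radial_point_in_ball[OF x t]]]
        by (simp add: has_vector_derivative_def linear_cmul)
    qed
    from fundamental_theorem_of_calculus[OF _ this]
    have "((\<lambda>t. ?F' (c + t *\<^sub>R (x - c)) (x - c)) has_integral F x - F c) {0..1}"
      by simp
    moreover have "((\<lambda>t. ?F' (c + t *\<^sub>R (x - c)) (x - c)) has_integral
        (\<Sum>i\<in>Basis. ((x - c) \<bullet> i) * ?G i x)) {0..1}"
    proof (rule has_integral_eq[rotated])
      show "((\<lambda>t. \<Sum>i\<in>Basis. ((x - c) \<bullet> i) * (t ^ 0 * ?F' (c + t *\<^sub>R (x - c)) i)) has_integral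
          (\<Sum>i\<in>Basis. ((x - c) \<bullet> i) * ?G i x)) {0..1}"
        by (intro has_integral_sum finite_Basis has_integral_mult_right integrable_integral
            integrable_continuous_real continuous_on_radial_integrand_slice[OF _ x]
            Ck_on_imp_continuous_on[OF F'])
      fix t :: real assume t: "t \<in> {0..1}"
      have lin: "linear (?F' (c + t *\<^sub>R (x - c)))"
        using has_derivative_linear[OF der[OF radial_point_in_ball[OF x t]]] .
      have "?F' (c + t *\<^sub>R (x - c)) (x - c) =
          ?F' (c + t *\<^sub>R (x - c)) (\<Sum>i\<in>Basis. ((x - c) \<bullet> i) *\<^sub>R i)"
        by (simp only: euclidean_representation)
      also have "\<dots> = (\<Sum>i\<in>Basis. ((x - c) \<bullet> i) * ?F' (c + t *\<^sub>R (x - c)) i)"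
        by (simp only: linear_sum[OF lin] linear_cmul[OF lin] real_scaleR_def)
      finally show "(\<Sum>i\<in>Basis. ((x - c) \<bullet> i) * (t ^ 0 * ?F' (c + t *\<^sub>R (x - c)) i)) =
          ?F' (c + t *\<^sub>R (x - c)) (x - c)" by simp
    qed
    ultimately show ?thesis
      by (auto dest: has_integral_unique)
  qed
qed

lemma sum_fun_apply: "(\<Sum>i\<in>I. f i) x = (\<Sum>i\<in>I. f i x)"
  by (induction I rule: infinite_finite_induct) auto

section \<open>Smooth functions supported in a chart\<close>

lemma chart_properties:
  assumes "smooth_atlas A" "(U, \<phi>) \<in> A"
  shows "open U" "open (\<phi> ` U)" "homeomorphism U (\<phi> ` U) \<phi> (inv_into U \<phi>)" "inj_on \<phi> U"
proof -
  show "open U" "open (\<phi> ` U)" and h: "homeomorphism U (\<phi> ` U) \<phi> (inv_into U \<phi>)"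
    using assms unfolding smooth_atlas_def by blast+
  show "inj_on \<phi> U"
    by (rule inj_on_inverseI[of _ "inv_into U \<phi>"]) (use h in \<open>simp add: homeomorphism_def\<close>)
qed

lemma open_chart_image:
  assumes "smooth_atlas A" "(U, \<phi>) \<in> A" "open N"
  shows "open (\<phi> ` (U \<inter> N))"
proof -
  note ch = chart_properties[OF assms(1,2)]
  have "\<phi> ` (U \<inter> N) = \<phi> ` U \<inter> inv_into U \<phi> -` N"
    using ch(4) by auto
  moreover have "open (\<phi> ` U \<inter> inv_into U \<phi> -` N)"
    using ch(2,3) assms(3) by (intro continuous_open_preimage) (auto simp: homeomorphism_def)
  ultimately show ?thesis by simp
qed

definition extend_by_zero ::
  "'m set \<Rightarrow> ('m \<Rightarrow> 'e::euclidean_space) \<Rightarrow> 'e \<Rightarrow> real \<Rightarrow> ('e \<Rightarrow> real) \<Rightarrow> 'm \<Rightarrow> real" where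
  "extend_by_zero U \<phi> c R h = (\<lambda>q. if q \<in> U \<and> \<phi> q \<in> ball c R then h (\<phi> q) else 0)"

text \<open>
  In another chart the extension is the composition of \<open>h\<close> with a transition map on the image of the
  open set \<open>N\<close> corresponding to the ball, and it is zero off the compact set \<open>K\<close> corresponding to the
  smaller closed ball. The complement of \<open>K\<close> is open because compact sets are closed in a Hausdorff
  space, so the two regions form an open cover. Without the Hausdorff property the extension could
  fail to be continuous.
\<close>

lemma smooth_fun_extend_by_zero:
  assumes A: "smooth_atlas A" and U: "(U, \<phi>) \<in> A"
    and ball: "ball c R \<subseteq> \<phi> ` U" and r: "r < R"
    and h: "smooth_on (ball c R) h"
    and supp: "\<And>x. x \<in> ball c R \<Longrightarrow> x \<notin> cball c r \<Longrightarrow> h x = 0"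
  shows "smooth_fun A (extend_by_zero U \<phi> c R h)"
  unfolding smooth_fun_def
proof safe
  fix V \<psi> assume V: "(V, \<psi>) \<in> A"
  note chU = chart_properties[OF A U] and chV = chart_properties[OF A V]
  let ?E = "extend_by_zero U \<phi> c R h"
  define N where "N = U \<inter> \<phi> -` ball c R"
  define K where "K = inv_into U \<phi> ` cball c r"
  have oN: "open N"
    unfolding N_def using chU(1,3) by (intro continuous_open_preimage) (auto simp: homeomorphism_def)
  have rball: "cball c r \<subseteq> ball c R" using r by auto
  have "compact K"
    unfolding K_def using chU(3) ball rball
    by (intro compact_continuous_image compact_cball)
      (auto simp: homeomorphism_def intro: continuous_on_subset)
  then have cK: "open (- K)"
    by (simp add: compact_imp_closed open_Compl)
  show "smooth_on (\<psi> ` V) (?E \<circ> inv_into V \<psi>)"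
    unfolding smooth_on_def
  proof (intro allI Ck_on_local)
    fix k y assume y: "y \<in> \<psi> ` V"
    then obtain q where q: "q \<in> V" "y = \<psi> q" by blast
    show "\<exists>W. open W \<and> y \<in> W \<and> Ck_on k W (?E \<circ> inv_into V \<psi>)"
    proof (cases "q \<in> N")
      case True
      let ?W = "\<psi> ` (V \<inter> N)"
      have "Ck_on k (\<psi> ` (V \<inter> U)) (\<phi> \<circ> inv_into V \<psi>)"
        using A U V unfolding smooth_atlas_def smooth_on_def by blast
      then have "Ck_on k ?W (\<phi> \<circ> inv_into V \<psi>)"
        by (rule Ck_on_subset) (auto simp: N_def)
      moreover have "(\<phi> \<circ> inv_into V \<psi>) ` ?W \<subseteq> ball c R"
        using chV(4) by (auto simp: N_def)
      moreover have "Ck_on k (ball c R) h"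
        using h by (simp add: smooth_on_def)
      ultimately have "Ck_on k ?W (\<lambda>x. h ((\<phi> \<circ> inv_into V \<psi>) x))"
        by (intro Ck_on_compose[OF open_chart_image[OF A V oN], of k "ball c R" h])
      then have "Ck_on k ?W (?E \<circ> inv_into V \<psi>)"
        by (rule Ck_on_cong[OF open_chart_image[OF A V oN], rotated])
          (use chV(4) in \<open>auto simp: N_def extend_by_zero_def\<close>)
      then show ?thesis
        using open_chart_image[OF A V oN] True q by blast
    next
      case False
      let ?W = "\<psi> ` (V \<inter> - K)"
      have "K \<subseteq> N"
      proof
        fix x assume "x \<in> K"
        then obtain z where z: "z \<in> cball c r" "x = inv_into U \<phi> z" by (auto simp: K_def)
        then have "z \<in> \<phi> ` U" "z \<in> ball c R" using ball rball by blast+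
        then show "x \<in> N" using z(2) by (simp add: N_def inv_into_into f_inv_into_f)
      qed
      then have "y \<in> ?W" using False q by auto
      have E0: "?E x = 0" if "x \<notin> K" for x
      proof (cases "x \<in> N")
        case True
        have "\<phi> x \<notin> cball c r"
        proof
          assume "\<phi> x \<in> cball c r"
          then have "inv_into U \<phi> (\<phi> x) \<in> K" by (auto simp: K_def)
          then show False using that True chU(4) by (simp add: N_def)
        qed
        then show ?thesis using supp True by (simp add: N_def extend_by_zero_def)
      qed (auto simp: N_def extend_by_zero_def)
      have "Ck_on k ?W (?E \<circ> inv_into V \<psi>)"
        by (rule Ck_on_cong[OF open_chart_image[OF A V cK] _ Ck_on_const[of _ _ 0]])
          (use chV(4) E0 in auto)
      with \<open>y \<in> ?W\<close> show ?thesis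
        using open_chart_image[OF A V cK] by blast
    qed
  qed
qed

lemma smooth_fun_chart_ball:
  assumes "smooth_fun A f" "(U, \<phi>) \<in> A" "ball c R \<subseteq> \<phi> ` U"
  shows "smooth_on (ball c R) (f \<circ> inv_into U \<phi>)"
  using assms Ck_on_subset unfolding smooth_fun_def smooth_on_def by blast

lemma smooth_fun_const: "smooth_fun A (\<lambda>q. a)"
  by (auto simp: smooth_fun_def smooth_on_def o_def Ck_on_const)

lemma smooth_fun_add:
  assumes "smooth_atlas A" "smooth_fun A f" "smooth_fun A h"
  shows "smooth_fun A (f + h)"
  using assms chart_properties(2)[OF assms(1)]
  by (auto simp: smooth_fun_def smooth_on_def o_def intro!: Ck_on_add)

lemma smooth_fun_mult:
  assumes "smooth_atlas A" "smooth_fun A f" "smooth_fun A h"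
  shows "smooth_fun A (f * h)"
  using assms chart_properties(2)[OF assms(1)]
  by (auto simp: smooth_fun_def smooth_on_def o_def intro!: Ck_on_mult)

lemma smooth_fun_sum:
  assumes "smooth_atlas A" "\<And>i. i \<in> I \<Longrightarrow> smooth_fun A (f i)"
  shows "smooth_fun A (\<Sum>i\<in>I. f i)"
  using assms(2)
  by (induction I rule: infinite_finite_induct)
    (auto simp: smooth_fun_const[of _ 0, folded zero_fun_def] intro: smooth_fun_add[OF assms(1)])

lemma tangent_sum:
  assumes "smooth_atlas A" "u \<in> tangent_space A p" "\<And>i. i \<in> I \<Longrightarrow> smooth_fun A (f i)"
  shows "u (\<Sum>i\<in>I. f i) = (\<Sum>i\<in>I. u (f i))"
proof -
  have "u (\<lambda>q. 0 * (0::real)) = 0 * u (\<lambda>q. 0)"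
    using assms(2) smooth_fun_const[of A 0] unfolding tangent_space_def by blast
  then have "u 0 = 0" by (simp add: zero_fun_def)
  moreover have "u (f + h) = u f + u h" if "smooth_fun A f" "smooth_fun A h" for f h
    using assms(2) that unfolding tangent_space_def by blast
  ultimately show ?thesis
    using assms(3)
    by (induction I rule: infinite_finite_induct) (simp_all add: smooth_fun_sum[OF assms(1)])
qed

lemma chart_ball_exists:
  assumes "smooth_atlas A"
  obtains U \<phi> R where "(U, \<phi>) \<in> A" "p \<in> U" "0 < R" "ball (\<phi> p) R \<subseteq> \<phi> ` U"
proof -
  have "p \<in> (\<Union>(U, \<phi>)\<in>A. U)" using assms by (simp add: smooth_atlas_def)
  then obtain U \<phi> where U: "(U, \<phi>) \<in> A" "p \<in> U" by blast
  then have "open (\<phi> ` U)" "\<phi> p \<in> \<phi> ` U"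
    using chart_properties(2)[OF assms] by auto
  then show ?thesis
    using that[OF U] by (auto elim: openE)
qed

section \<open>Derivations and global vector fields\<close>

text \<open>
  Let \<open>B\<close> be the extension by zero of a bump function with \<open>B p = 1\<close>, let \<open>x\<^sub>i\<close> be the coordinates
  centred at \<open>p\<close> and \<open>G\<^sub>i\<close> Hadamard's coefficients of \<open>f\<close>, the latter two cut off by \<open>B\<close>. Then
  \<open>B\<^sup>2 f = f(p) B\<^sup>2 + \<Sum>\<^sub>i x\<^sub>i G\<^sub>i\<close> holds on the whole manifold between smooth functions. Applying the
  derivation \<open>u\<close>, the terms with \<open>u (B\<^sup>2)\<close> cancel, and since \<open>x\<^sub>i\<close> vanishes at \<open>p\<close> what remains is
  \<open>u f = \<Sum>\<^sub>i u(x\<^sub>i) G\<^sub>i(p)\<close>, where \<open>G\<^sub>i(p)\<close> is the \<open>i\<close>-th partial derivative.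
\<close>

lemma tangent_vector_eq_directional_derivative:
  assumes A: "smooth_atlas A" and u: "u \<in> tangent_space A p"
    and U: "(U, \<phi>) \<in> A" "p \<in> U" and R: "0 < R" "ball (\<phi> p) R \<subseteq> \<phi> ` U"
  obtains a where
    "\<And>f. smooth_fun A f \<Longrightarrow> u f = frechet_derivative (f \<circ> inv_into U \<phi>) (at (\<phi> p)) a"
proof -
  define c where "c = \<phi> p"
  obtain b :: "'b \<Rightarrow> real" where b: "smooth_on UNIV b" "b c = 1" "\<And>x. x \<notin> cball c (R/2) \<Longrightarrow> b x = 0"
    using smooth_bump_exists[of "R/2" c] R(1) by auto
  let ?E = "\<lambda>h. extend_by_zero U \<phi> c R (\<lambda>x. b x * h x)"
  have E: "smooth_fun A (?E h)" if h: "smooth_on (ball c R) h" for h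
  proof (rule smooth_fun_extend_by_zero[OF A U(1)])
    show "smooth_on (ball c R) (\<lambda>x. b x * h x)"
      using b(1) h Ck_on_subset[OF _ subset_UNIV] unfolding smooth_on_def
      by (blast intro: Ck_on_mult[OF open_ball])
    show "b x * h x = 0" if "x \<notin> cball c (R/2)" for x
      using b(3)[OF that] by simp
  qed (use R in \<open>simp_all add: c_def\<close>)
  have Ep: "?E h p = h c" for h
    using U R b(2) by (simp add: extend_by_zero_def c_def)
  let ?B = "?E (\<lambda>_. 1)" and ?x = "\<lambda>i. ?E (\<lambda>x. (x - c) \<bullet> i)"
  have B: "smooth_fun A ?B"
    by (rule E) (simp add: smooth_on_def Ck_on_const)
  have "Ck_on k (ball c R) (\<lambda>x. (x - c) \<bullet> i)" for k i
    using Ck_on_add[OF open_ball Ck_on_ident[OF open_ball] Ck_on_const[of _ _ "-c"], of k c R]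
    by (intro Ck_on_bounded_linear_compose[OF open_ball bounded_linear_inner_left]) simp
  then have x: "smooth_fun A (?x i)" for i
    by (intro E) (simp add: smooth_on_def)
  have u_add: "u (f + h) = u f + u h" and u_mult: "u (f * h) = u f * h p + f p * u h"
    if "smooth_fun A f" "smooth_fun A h" for f h
    using u that unfolding tangent_space_def by blast+
  have u_scale: "u (\<lambda>q. a * f q) = a * u f" if "smooth_fun A f" for a f
    using u that unfolding tangent_space_def by blast
  show thesis
  proof
    fix f assume f: "smooth_fun A f"
    let ?F = "f \<circ> inv_into U \<phi>"
    have F: "smooth_on (ball c R) ?F"
      using smooth_fun_chart_ball[OF f U(1)] R(2) by (simp add: c_def)
    obtain G where G: "\<And>i. smooth_on (ball c R) (G i)" "\<And>i. G i c = frechet_derivative ?F (at c) i"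
      "\<And>x. x \<in> ball c R \<Longrightarrow> ?F x = ?F c + (\<Sum>i\<in>Basis. ((x - c) \<bullet> i) * G i x)"
      by (rule smooth_on_Hadamard[OF F R(1)]) (rule that)
    have Fphi: "?F (\<phi> q) = f q" if "q \<in> U" for q
      using that chart_properties(4)[OF A U(1)] by simp
    have eq: "?B * ?B * f = (\<lambda>q. f p * (?B * ?B) q) + (\<Sum>i\<in>Basis. ?x i * ?E (G i))"
    proof
      fix q
      show "(?B * ?B * f) q = ((\<lambda>q. f p * (?B * ?B) q) + (\<Sum>i\<in>Basis. ?x i * ?E (G i))) q"
      proof (cases "q \<in> U \<and> \<phi> q \<in> ball c R")
        case True
        have "?F (\<phi> q) = ?F c + (\<Sum>i\<in>Basis. ((\<phi> q - c) \<bullet> i) * G i (\<phi> q))"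
          by (rule G(3)[OF conjunct2[OF True]])
        moreover have "?F (\<phi> q) = f q" "?F c = f p"
          unfolding c_def by (rule Fphi[OF conjunct1[OF True]], rule Fphi[OF U(2)])
        ultimately have "f q = f p + (\<Sum>i\<in>Basis. ((\<phi> q - c) \<bullet> i) * G i (\<phi> q))"
          by (simp only:)
        moreover have "(\<Sum>i\<in>Basis. ?x i * ?E (G i)) q =
            b (\<phi> q) * b (\<phi> q) * (\<Sum>i\<in>Basis. ((\<phi> q - c) \<bullet> i) * G i (\<phi> q))"
          using True by (simp add: extend_by_zero_def sum_fun_apply sum_distrib_left mult_ac)
        ultimately show ?thesis
          using True by (simp add: extend_by_zero_def algebra_simps)
      next
        case False
        then have "(\<Sum>i\<in>Basis. ?x i * ?E (G i)) q = 0"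
          unfolding sum_fun_apply by (intro sum.neutral) (auto simp: extend_by_zero_def)
        then show ?thesis
          using False by (auto simp: extend_by_zero_def)
      qed
    qed
    have BB: "smooth_fun A (?B * ?B)"
      by (rule smooth_fun_mult[OF A B B])
    have xG: "smooth_fun A (?x i * ?E (G i))" for i
      by (rule smooth_fun_mult[OF A x E[OF G(1)]])
    have "(?B * ?B) p = 1"
      by (simp only: times_fun_def Ep mult_1)
    then have "u (?B * ?B * f) = u (?B * ?B) * f p + u f"
      using u_mult[OF BB f] by (simp only: mult_1)
    moreover have "u ((\<lambda>q. f p * (?B * ?B) q) + (\<Sum>i\<in>Basis. ?x i * ?E (G i))) =
        f p * u (?B * ?B) + (\<Sum>i\<in>Basis. u (?x i * ?E (G i)))"
    proof -
      have "smooth_fun A (\<lambda>q. f p * (?B * ?B) q)"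
        using smooth_fun_mult[OF A smooth_fun_const[of A "f p"] BB] by (simp only: times_fun_def)
      moreover have "smooth_fun A (\<Sum>i\<in>Basis. ?x i * ?E (G i))"
        by (rule smooth_fun_sum[OF A xG])
      moreover have "u (\<Sum>i\<in>Basis. ?x i * ?E (G i)) = (\<Sum>i\<in>Basis. u (?x i * ?E (G i)))"
        by (rule tangent_sum[OF A u xG])
      ultimately show ?thesis
        using u_add u_scale[OF BB, of "f p"] by (simp only:)
    qed
    ultimately have "u (?B * ?B) * f p + u f =
        f p * u (?B * ?B) + (\<Sum>i\<in>Basis. u (?x i * ?E (G i)))"
      unfolding eq by (rule trans[OF sym])
    then have "u f = (\<Sum>i\<in>Basis. u (?x i * ?E (G i)))"
      by (simp only: mult.commute[of "f p"] add_left_cancel)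
    also have "\<dots> = (\<Sum>i\<in>Basis. u (?x i) * frechet_derivative ?F (at c) i)"
      using u_mult[OF x E[OF G(1)]] by (simp add: Ep G(2))
    also have "\<dots> = frechet_derivative ?F (at c) (\<Sum>i\<in>Basis. u (?x i) *\<^sub>R i)"
    proof -
      have "Ck_on (Suc 0) (ball c R) ?F" using F unfolding smooth_on_def by blast
      from has_derivative_linear[OF Ck_on_has_derivative[OF this]]
      have lin: "linear (frechet_derivative ?F (at c))"
        using R(1) by simp
      show ?thesis
        by (simp only: linear_sum[OF lin] linear_cmul[OF lin] real_scaleR_def)
    qed
    finally show "u f = frechet_derivative ?F (at (\<phi> p)) (\<Sum>i\<in>Basis. u (?x i) *\<^sub>R i)"
      by (simp add: c_def)
  qed
qed

text \<open>
  The field differentiates in a constant coordinate direction, damped by a bump function that is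
  \<open>1\<close> at \<open>p\<close> so that the value at \<open>p\<close> is not changed.
\<close>

lemma tangent_vector_extends_to_vector_field:
  assumes A: "smooth_atlas A" and u: "u \<in> tangent_space A p"
  obtains X where "X \<in> vector_fields A" "X p = u"
proof -
  obtain U \<phi> R where U: "(U, \<phi>) \<in> A" "p \<in> U" and R: "0 < R" "ball (\<phi> p) R \<subseteq> \<phi> ` U"
    by (rule chart_ball_exists[OF A])
  define c where "c = \<phi> p"
  obtain a where a: "\<And>f. smooth_fun A f \<Longrightarrow> u f = frechet_derivative (f \<circ> inv_into U \<phi>) (at c) a"
    by (rule tangent_vector_eq_directional_derivative[OF A u U R, folded c_def]) (rule that)
  obtain b :: "'b \<Rightarrow> real" where b: "smooth_on UNIV b" "b c = 1" "\<And>x. x \<notin> cball c (R/2) \<Longrightarrow> b x = 0"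
    using smooth_bump_exists[of "R/2" c] R(1) by auto
  let ?D = "\<lambda>f x. frechet_derivative (f \<circ> inv_into U \<phi>) (at x) a"
  \<comment> \<open>Tangent vectors take the value \<open>0\<close> on functions that are not smooth, hence the case distinction.\<close>
  define X where "X q f = (if smooth_fun A f
    then extend_by_zero U \<phi> c R (\<lambda>x. b x * ?D f x) q else 0)" for q f
  have der: "((f \<circ> inv_into U \<phi>) has_derivative frechet_derivative (f \<circ> inv_into U \<phi>) (at x)) (at x)"
    if "smooth_fun A f" "x \<in> ball c R" for f x
  proof -
    have "Ck_on (Suc 0) (ball c R) (f \<circ> inv_into U \<phi>)"
      using smooth_fun_chart_ball[OF that(1) U(1)] R(2) unfolding smooth_on_def c_def by blast
    then show ?thesis using that(2) by (rule Ck_on_has_derivative)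
  qed
  have D_add: "?D (f + h) x = ?D f x + ?D h x"
    and D_mult: "?D (f * h) x = (f \<circ> inv_into U \<phi>) x * ?D h x + ?D f x * (h \<circ> inv_into U \<phi>) x"
    if "smooth_fun A f" "smooth_fun A h" "x \<in> ball c R" for f h x
  proof -
    have "(f + h) \<circ> inv_into U \<phi> = (\<lambda>x. (f \<circ> inv_into U \<phi>) x + (h \<circ> inv_into U \<phi>) x)"
      by (simp add: fun_eq_iff)
    then show "?D (f + h) x = ?D f x + ?D h x"
      using fun_cong[OF frechet_derivative_at[OF has_derivative_add[OF
          der[OF that(1,3)] der[OF that(2,3)]]], of a]
      by (simp only:)
    have "(f * h) \<circ> inv_into U \<phi> = (\<lambda>x. (f \<circ> inv_into U \<phi>) x * (h \<circ> inv_into U \<phi>) x)"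
      by (simp add: fun_eq_iff)
    then show "?D (f * h) x = (f \<circ> inv_into U \<phi>) x * ?D h x + ?D f x * (h \<circ> inv_into U \<phi>) x"
      using fun_cong[OF frechet_derivative_at[OF has_derivative_mult[OF
          der[OF that(1,3)] der[OF that(2,3)]]], of a]
      by (simp only:)
  qed
  have D_scale: "?D (\<lambda>q. s * f q) x = s * ?D f x" if "smooth_fun A f" "x \<in> ball c R" for s f x
  proof -
    have "(\<lambda>q. s * f q) \<circ> inv_into U \<phi> = (\<lambda>x. s * (f \<circ> inv_into U \<phi>) x)"
      by (simp add: fun_eq_iff)
    then show ?thesis
      using fun_cong[OF frechet_derivative_at[OF has_derivative_mult_right[OF der[OF that], of s]], of a]
      by (simp only:)
  qed
  have smooth_scale: "smooth_fun A (\<lambda>q. s * f q)" if "smooth_fun A f" for s f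
    using smooth_fun_mult[OF A smooth_fun_const that] by (simp add: times_fun_def)
  have inv: "inv_into U \<phi> (\<phi> q) = q" if "q \<in> U" for q
    using that chart_properties(4)[OF A U(1)] by simp
  have "X q \<in> tangent_space A q" for q
    unfolding tangent_space_def
  proof (intro CollectI conjI allI impI)
    fix f h :: "'a \<Rightarrow> real" assume fh: "smooth_fun A f" "smooth_fun A h"
    show "X q (f + h) = X q f + X q h"
      using fh smooth_fun_add[OF A fh] D_add[OF fh, of "\<phi> q"]
      by (simp add: X_def extend_by_zero_def distrib_left)
    show "X q (f * h) = X q f * h q + f q * X q h"
      using fh smooth_fun_mult[OF A fh] D_mult[OF fh, of "\<phi> q"] inv[of q]
      by (simp add: X_def extend_by_zero_def algebra_simps)
  next
    fix s and f :: "'a \<Rightarrow> real" assume "smooth_fun A f"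
    then show "X q (\<lambda>q. s * f q) = s * X q f"
      using smooth_scale[of f s] D_scale[of f "\<phi> q" s] by (simp add: X_def extend_by_zero_def)
  qed (simp add: X_def)
  moreover have "smooth_fun A (vf_apply X f)" if f: "smooth_fun A f" for f
  proof -
    have "smooth_on (ball c R) (f \<circ> inv_into U \<phi>)"
      using smooth_fun_chart_ball[OF f U(1)] R(2) by (simp add: c_def)
    then have "Ck_on k (ball c R) (?D f)" for k
      unfolding smooth_on_def using Ck_on.simps(2)[of k] by blast
    moreover have "Ck_on k (ball c R) b" for k
      using b(1) Ck_on_subset[OF _ subset_UNIV] unfolding smooth_on_def by blast
    ultimately have "smooth_on (ball c R) (\<lambda>x. b x * ?D f x)"
      by (simp add: smooth_on_def Ck_on_mult)
    then have "smooth_fun A (extend_by_zero U \<phi> c R (\<lambda>x. b x * ?D f x))"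
      using smooth_fun_extend_by_zero[OF A U(1), of c R "R/2" "\<lambda>x. b x * ?D f x"] R b(3)
      by (simp add: c_def del: mem_cball)
    then show ?thesis using f by (simp add: vf_apply_def X_def)
  qed
  ultimately have "X \<in> vector_fields A" by (simp add: vector_fields_def)
  moreover have "X p = u"
  proof
    fix f
    show "X p f = u f"
    proof (cases "smooth_fun A f")
      case True
      then show ?thesis
        using U(2) R(1) b(2) a by (simp add: X_def extend_by_zero_def c_def)
    next
      case False
      then show ?thesis using u by (simp add: X_def tangent_space_def)
    qed
  qed
  ultimately show thesis by (rule that)
qed

section \<open>The splitting of the tangent spaces along a unit vector field\<close>

lemma tangent_space_add:
  assumes "u \<in> tangent_space A p" "v \<in> tangent_space A p"
  shows "u + v \<in> tangent_space A p"
  using assms unfolding tangent_space_def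
  by (auto simp: algebra_simps)

lemma tangent_space_tscale:
  assumes "u \<in> tangent_space A p"
  shows "tscale a u \<in> tangent_space A p"
  using assms unfolding tangent_space_def tscale_def
  by (auto simp: algebra_simps)

lemma vector_fields_add:
  assumes "smooth_atlas A" "X \<in> vector_fields A" "Y \<in> vector_fields A"
  shows "X + Y \<in> vector_fields A"
proof -
  have "vf_apply (X + Y) f = vf_apply X f + vf_apply Y f" for f
    by (simp add: vf_apply_def fun_eq_iff)
  then show ?thesis
    using assms by (simp add: vector_fields_def tangent_space_add smooth_fun_add)
qed

lemma vector_fields_fscale:
  assumes "smooth_atlas A" "smooth_fun A h" "X \<in> vector_fields A"
  shows "fscale h X \<in> vector_fields A"
proof -
  have "vf_apply (fscale h X) f = h * vf_apply X f" for f
    by (simp add: vf_apply_def fscale_def tscale_def fun_eq_iff)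
  then show ?thesis
    using assms by (simp add: vector_fields_def fscale_def tangent_space_tscale smooth_fun_mult)
qed

lemma vector_field_tangent: "X \<in> vector_fields A \<Longrightarrow> X p \<in> tangent_space A p"
  by (simp add: vector_fields_def)

lemma metric_sym:
  assumes "riemannian_metric A g" "u \<in> tangent_space A p" "v \<in> tangent_space A p"
  shows "g p u v = g p v u"
  using assms unfolding riemannian_metric_def by blast

lemma metric_add_right:
  assumes "riemannian_metric A g"
    "u \<in> tangent_space A p" "v \<in> tangent_space A p" "w \<in> tangent_space A p"
  shows "g p u (v + w) = g p u v + g p u w"
  using assms unfolding riemannian_metric_def linear_form_at_def by blast

lemma metric_scale_right:
  assumes "riemannian_metric A g" "u \<in> tangent_space A p" "v \<in> tangent_space A p"
  shows "g p u (tscale a v) = a * g p u v"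
  using assms unfolding riemannian_metric_def linear_form_at_def by blast

lemma metric_nondegenerate:
  assumes g: "riemannian_metric A g"
    and u: "u \<in> tangent_space A p" and v: "v \<in> tangent_space A p"
    and eq: "\<And>z. z \<in> tangent_space A p \<Longrightarrow> g p u z = g p v z"
  shows "u = v"
proof -
  let ?d = "u + tscale (-1) v"
  have d: "?d \<in> tangent_space A p"
    by (intro tangent_space_add u tangent_space_tscale v)
  have "g p ?d ?d = g p ?d u - g p ?d v"
    using metric_add_right[OF g d u tangent_space_tscale[OF v]] metric_scale_right[OF g d v]
    by simp
  also have "\<dots> = 0"
    unfolding metric_sym[OF g d u] metric_sym[OF g d v] eq[OF d] by (rule diff_self)
  finally have d0: "g p ?d ?d = 0" .
  have "?d \<noteq> 0 \<longrightarrow> g p ?d ?d > 0"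
    using g d unfolding riemannian_metric_def by blast
  with d0 have "?d = 0"
    by (metis less_irrefl)
  show ?thesis
  proof
    show "u f = v f" for f
      using fun_cong[OF \<open>?d = 0\<close>, of f] by (simp add: tscale_def)
  qed
qed

lemma orthogonal_projection:
  assumes g: "riemannian_metric A g"
    and \<xi>: "unit_vector_field A g \<xi>" and u: "u \<in> tangent_space A p"
  shows "u + tscale (- g p u (\<xi> p)) (\<xi> p) \<in> orth_space A g \<xi> p"
proof -
  have \<xi>p: "\<xi> p \<in> tangent_space A p" "g p (\<xi> p) (\<xi> p) = 1"
    using \<xi> by (simp_all add: unit_vector_field_def vector_fields_def)
  let ?u = "u + tscale (- g p u (\<xi> p)) (\<xi> p)"
  have tan: "?u \<in> tangent_space A p"
    by (intro tangent_space_add u tangent_space_tscale \<xi>p)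
  have "g p ?u (\<xi> p) = g p (\<xi> p) ?u"
    by (rule metric_sym[OF g tan \<xi>p(1)])
  also have "\<dots> = g p (\<xi> p) u + (- g p u (\<xi> p)) * g p (\<xi> p) (\<xi> p)"
    by (simp only: metric_add_right[OF g \<xi>p(1) u tangent_space_tscale[OF \<xi>p(1)]]
        metric_scale_right[OF g \<xi>p(1) \<xi>p(1)])
  also have "\<dots> = 0"
    unfolding \<xi>p(2) metric_sym[OF g \<xi>p(1) u] by simp
  finally show ?thesis
    using tan by (simp add: orth_space_def)
qed

text \<open>
  Extend arbitrarily and subtract the \<open>\<xi>\<close>-component everywhere; at \<open>p\<close> there is nothing to subtract.
\<close>

lemma orth_vector_extends_to_orth_field:
  assumes g: "riemannian_metric A g" and A: "smooth_atlas A"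
    and \<xi>: "unit_vector_field A g \<xi>" and u: "u \<in> orth_space A g \<xi> p"
  obtains X where "X \<in> orth_fields A g \<xi>" "X p = u"
proof -
  have u': "u \<in> tangent_space A p" "g p u (\<xi> p) = 0"
    using u by (auto simp: orth_space_def)
  obtain Y where Y: "Y \<in> vector_fields A" "Y p = u"
    using tangent_vector_extends_to_vector_field[OF A u'(1)] .
  define X where "X = Y + fscale (\<lambda>q. (-1) * g q (Y q) (\<xi> q)) \<xi>"
  have \<xi>v: "\<xi> \<in> vector_fields A"
    using \<xi> by (simp add: unit_vector_field_def)
  have "smooth_fun A (\<lambda>q. g q (Y q) (\<xi> q))"
    using g Y(1) \<xi>v unfolding riemannian_metric_def by blast
  from smooth_fun_mult[OF A smooth_fun_const[of A "-1"] this]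
  have "smooth_fun A (\<lambda>q. (-1) * g q (Y q) (\<xi> q))"
    by (simp only: times_fun_def)
  then have "X \<in> vector_fields A"
    unfolding X_def by (intro vector_fields_add[OF A] vector_fields_fscale[OF A] Y(1) \<xi>v)
  moreover have "X q \<in> orth_space A g \<xi> q" for q
    using orthogonal_projection[OF g \<xi> vector_field_tangent[OF Y(1), of q]]
    by (simp add: X_def fscale_def)
  ultimately have "X \<in> orth_fields A g \<xi>"
    by (simp add: orth_fields_def)
  moreover have "X p = u"
  proof
    fix f
    have "X p f = u f + (-1) * g p u (\<xi> p) * \<xi> p f"
      by (simp add: X_def fscale_def tscale_def Y(2))
    then show "X p f = u f" using u'(2) by simp
  qed
  ultimately show thesis by (rule that)
qed

text \<open>
  For \<open>n = \<xi> p\<close> the three terms on the right are a value on \<open>D \<times> D\<close>, one of the form \<open>S(X, \<xi>)\<close> and one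
  of the form \<open>S(\<xi>, Y)\<close>. The second argument of the last term is deliberately left unsplit, since
  \<open>S(\<xi>, Y)\<close> is known for all \<open>Y\<close>.
\<close>

lemma tensor12_split:
  assumes S: "tensor_field12 A S"
    and u: "u \<in> tangent_space A p" and v: "v \<in> tangent_space A p" and n: "n \<in> tangent_space A p"
  shows "S p (u + tscale a n) (v + tscale b n) =
    S p u v + tscale b (S p u n) + tscale a (S p n (v + tscale b n))"
proof
  fix f
  have lin: "linear_form_at A p (\<lambda>z. S p y z f)" "linear_form_at A p (\<lambda>z. S p z y f)"
    if "y \<in> tangent_space A p" for y
    using S that unfolding tensor_field12_def by blast+
  have v': "v + tscale b n \<in> tangent_space A p"
    by (intro tangent_space_add v tangent_space_tscale n)
  have "S p (u + tscale a n) (v + tscale b n) f =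
      S p u (v + tscale b n) f + a * S p n (v + tscale b n) f"
    using lin(2)[OF v'] u n tangent_space_tscale[OF n] by (simp add: linear_form_at_def)
  moreover have "S p u (v + tscale b n) f = S p u v f + b * S p u n f"
    using lin(1)[OF u] v n tangent_space_tscale[OF n] by (simp add: linear_form_at_def)
  ultimately show "S p (u + tscale a n) (v + tscale b n) f =
      (S p u v + tscale b (S p u n) + tscale a (S p n (v + tscale b n))) f"
    by (simp add: tscale_def[of _ "S p _ _"])
qed

section \<open>Components determined by the Levi-Civita connection\<close>

text \<open>This is \<open>\<xi>\<close> being parallel for \<open>\<nabla> - S\<close>.\<close>

lemma cohomogeneity_one_structure_xi_right:
  assumes "cohomogeneity_one_structure A g nabla \<xi> S" "X \<in> vector_fields A"
  shows "S p (X p) (\<xi> p) = nabla X \<xi> p"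
proof -
  have "conn_minus nabla S X \<xi> p = 0"
    using assms by (simp add: cohomogeneity_one_structure_def Let_def)
  then show ?thesis by (simp add: conn_minus_def fun_eq_iff)
qed

text \<open>
  As \<open>\<xi>\<close> is parallel, only one of the two covariant derivatives in the torsion of \<open>(\<xi>, X)\<close> survives,
  namely that of \<open>X\<close> along \<open>\<xi>\<close>.
\<close>

lemma cohomogeneity_one_structure_xi_left:
  assumes S: "cohomogeneity_one_structure A g nabla \<xi> S" and X: "X \<in> vector_fields A"
    and "torsion (conn_minus nabla S) \<xi> X = 0"
  shows "S p (\<xi> p) (X p) = nabla \<xi> X p - lie_bracket \<xi> X p"
proof -
  have "conn_minus nabla S \<xi> X p - conn_minus nabla S X \<xi> p - lie_bracket \<xi> X p = 0"
    using fun_cong[OF assms(3), of p] by (simp add: torsion_def)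
  moreover have "conn_minus nabla S X \<xi> p = 0"
    using S X by (simp add: cohomogeneity_one_structure_def Let_def)
  ultimately show ?thesis by (simp add: conn_minus_def fun_eq_iff algebra_simps)
qed

text \<open>
  Evaluate the covariant derivative of the metric along \<open>X\<close> on the pair \<open>(Y, \<xi>)\<close>: the term that
  differentiates \<open>\<xi>\<close> drops out, and the remaining ones can be solved for \<open>g(S(X, Y), \<xi>)\<close>. The field
  \<open>X\<close> must be orthogonal to \<open>\<xi>\<close>, as the metric is parallel only in these directions.
\<close>

lemma cohomogeneity_one_structure_xi_component:
  assumes S: "cohomogeneity_one_structure A g nabla \<xi> S" and g: "riemannian_metric A g"
    and nabla: "linear_connection A nabla"
    and \<xi>: "\<xi> \<in> vector_fields A" and X: "X \<in> orth_fields A g \<xi>" and Y: "Y \<in> vector_fields A"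
  shows "g p (S p (X p) (Y p)) (\<xi> p) = g p (nabla X Y p) (\<xi> p) - X p (\<lambda>q. g q (Y q) (\<xi> q))"
proof -
  let ?n = "conn_minus nabla S"
  have X': "X \<in> vector_fields A" using X by (simp add: orth_fields_def)
  have par: "cov_deriv_metric ?n g X Y \<xi> = 0" "?n X \<xi> = 0"
    using S X X' Y \<xi> by (simp_all add: cohomogeneity_one_structure_def Let_def)
  note tan = vector_field_tangent
  have \<xi>p: "\<xi> p \<in> tangent_space A p" and Yp: "Y p \<in> tangent_space A p"
    by (rule tan[OF \<xi>], rule tan[OF Y])
  have "tensor_field12 A S" using S by (simp add: cohomogeneity_one_structure_def)
  then have Sp: "S p (X p) (Y p) \<in> tangent_space A p"
    using tan[OF X'] tan[OF Y] unfolding tensor_field12_def by blast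
  have "nabla X Y \<in> vector_fields A"
    using nabla X' Y by (simp add: linear_connection_def)
  then have Np: "nabla X Y p \<in> tangent_space A p" by (rule tan)
  have "tscale 0 (\<xi> p) = 0" by (simp add: tscale_def fun_eq_iff)
  then have g0: "g p (Y p) 0 = 0"
    using metric_scale_right[OF g Yp \<xi>p, of 0] by simp
  have "?n X Y p = nabla X Y p + tscale (-1) (S p (X p) (Y p))"
    by (simp add: conn_minus_def tscale_def fun_eq_iff)
  then have "g p (\<xi> p) (?n X Y p) = g p (\<xi> p) (nabla X Y p) - g p (\<xi> p) (S p (X p) (Y p))"
    using metric_add_right[OF g \<xi>p Np tangent_space_tscale[OF Sp]] metric_scale_right[OF g \<xi>p Sp]
    by simp
  moreover have "?n X Y p \<in> tangent_space A p"
    using \<open>?n X Y p = _\<close> tangent_space_add[OF Np tangent_space_tscale[OF Sp]] by simp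
  ultimately have "g p (?n X Y p) (\<xi> p) = g p (nabla X Y p) (\<xi> p) - g p (S p (X p) (Y p)) (\<xi> p)"
    using metric_sym[OF g \<xi>p] Np Sp by simp
  moreover have "X p (\<lambda>q. g q (Y q) (\<xi> q)) - g p (?n X Y p) (\<xi> p) - g p (Y p) (?n X \<xi> p) = 0"
    using fun_cong[OF par(1), of p] by (simp add: cov_deriv_metric_def)
  ultimately show ?thesis
    using par(2) g0 by simp
qed

theorem proposition6p7:
  fixes A :: "('m::{t2_space, second_countable_topology}, 'e::euclidean_space) atlas"
    and g :: "'m metric" and nabla :: "'m conn" and \<xi> :: "'m vfield"
    and S1 S2 :: "'m tensor12"
  assumes "smooth_atlas A"
    and "riemannian_metric A g"
    and "levi_civita A g nabla"
    and "unit_vector_field A g \<xi>"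
    and "cohomogeneity_one_structure A g nabla \<xi> S1"
    and "cohomogeneity_one_structure A g nabla \<xi> S2"
    and "\<And>X. X \<in> vector_fields A \<Longrightarrow> torsion (conn_minus nabla S1) \<xi> X = 0"
    and "\<And>X. X \<in> vector_fields A \<Longrightarrow> torsion (conn_minus nabla S2) \<xi> X = 0"
    and "\<And>p. Pi_T A g \<xi> S1 p = Pi_T A g \<xi> S2 p"
  shows "\<forall>p. \<forall>u\<in>tangent_space A p. \<forall>v\<in>tangent_space A p. S1 p u v = S2 p u v"
proof (intro allI ballI)
  note A = assms(1) and g = assms(2) and \<xi> = assms(4) and S1 = assms(5) and S2 = assms(6)
  have nabla: "linear_connection A nabla"
    using assms(3) by (simp add: levi_civita_def)
  have tensor: "tensor_field12 A S1" "tensor_field12 A S2"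
    using S1 S2 by (simp_all add: cohomogeneity_one_structure_def)
  have \<xi>v: "\<xi> \<in> vector_fields A" using \<xi> by (simp add: unit_vector_field_def)
  fix p
  have \<xi>p: "\<xi> p \<in> tangent_space A p" by (rule vector_field_tangent[OF \<xi>v])
  have right: "S1 p u (\<xi> p) = S2 p u (\<xi> p)" if u: "u \<in> tangent_space A p" for u
  proof -
    obtain X where "X \<in> vector_fields A" "X p = u"
      using tangent_vector_extends_to_vector_field[OF A u] .
    then show ?thesis
      using cohomogeneity_one_structure_xi_right[OF S1, of X p]
        cohomogeneity_one_structure_xi_right[OF S2, of X p] by simp
  qed
  have left: "S1 p (\<xi> p) v = S2 p (\<xi> p) v" if v: "v \<in> tangent_space A p" for v
  proof -
    obtain X where X: "X \<in> vector_fields A" "X p = v"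
      using tangent_vector_extends_to_vector_field[OF A v] .
    then show ?thesis
      using cohomogeneity_one_structure_xi_left[OF S1 X(1) assms(7)[OF X(1)], of p]
        cohomogeneity_one_structure_xi_left[OF S2 X(1) assms(8)[OF X(1)], of p] by simp
  qed
  have orth: "S1 p u v = S2 p u v"
    if u: "u \<in> orth_space A g \<xi> p" and v: "v \<in> orth_space A g \<xi> p" for u v
  proof (rule metric_nondegenerate[OF g])
    have uv: "u \<in> tangent_space A p" "v \<in> tangent_space A p"
      using u v by (simp_all add: orth_space_def)
    show w1: "S1 p u v \<in> tangent_space A p" and w2: "S2 p u v \<in> tangent_space A p"
      using tensor uv unfolding tensor_field12_def by blast+
    obtain X where X: "X \<in> orth_fields A g \<xi>" "X p = u"
      using orth_vector_extends_to_orth_field[OF g A \<xi> u] .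
    obtain Y where Y: "Y \<in> vector_fields A" "Y p = v"
      using tangent_vector_extends_to_vector_field[OF A uv(2)] .
    have n: "g p (S1 p u v) (\<xi> p) = g p (S2 p u v) (\<xi> p)"
      using cohomogeneity_one_structure_xi_component[OF S1 g nabla \<xi>v X(1) Y(1), of p]
        cohomogeneity_one_structure_xi_component[OF S2 g nabla \<xi>v X(1) Y(1), of p] X(2) Y(2)
      by simp
    fix z assume z: "z \<in> tangent_space A p"
    let ?z = "z + tscale (- g p z (\<xi> p)) (\<xi> p)"
    have z': "?z \<in> orth_space A g \<xi> p"
      by (rule orthogonal_projection[OF g \<xi> z])
    have "g p (S1 p u v) ?z = g p (S2 p u v) ?z"
      using fun_cong[OF fun_cong[OF fun_cong[OF assms(9)[of p], of u], of v], of ?z] u v z'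
      by (simp add: Pi_T_def)
    then show "g p (S1 p u v) z = g p (S2 p u v) z"
      using metric_add_right[OF g w1 z tangent_space_tscale[OF \<xi>p]] metric_scale_right[OF g w1 \<xi>p]
        metric_add_right[OF g w2 z tangent_space_tscale[OF \<xi>p]] metric_scale_right[OF g w2 \<xi>p] n
      by simp
  qed
  fix u v assume u: "u \<in> tangent_space A p" and v: "v \<in> tangent_space A p"
  define a b where "a = g p u (\<xi> p)" and "b = g p v (\<xi> p)"
  define u' v' where "u' = u + tscale (-a) (\<xi> p)" and "v' = v + tscale (-b) (\<xi> p)"
  have o: "u' \<in> orth_space A g \<xi> p" "v' \<in> orth_space A g \<xi> p"
    unfolding u'_def v'_def a_def b_def
    by (rule orthogonal_projection[OF g \<xi> u], rule orthogonal_projection[OF g \<xi> v])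
  then have t: "u' \<in> tangent_space A p" "v' \<in> tangent_space A p"
    by (simp_all add: orth_space_def)
  have uv: "u' + tscale a (\<xi> p) = u" "v' + tscale b (\<xi> p) = v"
    by (simp_all add: u'_def v'_def tscale_def fun_eq_iff)
  show "S1 p u v = S2 p u v"
    using tensor12_split[OF tensor(1) t \<xi>p, of a b] tensor12_split[OF tensor(2) t \<xi>p, of a b]
    unfolding uv by (simp only: orth[OF o] right[OF t(1)] left[OF v])
qed

end
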